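(* For any constant $c$, for any monotone DNF (or monotone CNF) $\varphi$ with arity and degree bounded by $c$, the smallest width of an OBDD for $\varphi$ is $2^{\Theta(\mathrm{pw}(\varphi))}$; that is, for every $c$ there are constants $0<\alpha\leq\beta$ and $p_0$ such that for every monotone DNF or monotone CNF $\varphi$ of arity at most $c$ and degree at most $c$ with $\mathrm{pw}(\varphi)\geq p_0$, the smallest width of an OBDD for $\varphi$ is between $2^{\alpha\,\mathrm{pw}(\varphi)}$ and $2^{\beta\,\mathrm{pw}(\varphi)}$.
   Context: A monotone DNF (resp. monotone CNF) on a finite set of variables $V$ is a disjunction of conjunctions (resp. conjunction of disjunctions) of variables of $V$; each such conjunction (resp. disjunction) is a clause, identified with the set of variables it contains. Monotone DNFs and CNFs are always assumed minimized (no clause is a subset of another) and to contain at least one non-empty clause. The hypergraph of $\varphi$ has the variables as vertices and the clauses as hyperedges. The arity of $\varphi$ is the maximal size of a hyperedge; the degree is the maximal number of hyperedges containing a given vertex. $\mathrm{pw}(\varphi)$ is the pathwidth of the hypergraph of $\varphi$: the minimal width of a path decomposition, i.e. of a path whose nodes (bags) are labeled by subsets of the vertices such that every hyperedge is contained in some bag and for each vertex the bags containing it form a connected subpath; width is the maximal bag size minus one. An OBDD on variables $V=\{v_1,\dots,v_n\}$ is a rooted DAG whose leaves are labeled $0$ or $1$ and whose internal nodes are labeled by a variable and have two outgoing edges labeled $0$ and $1$, such that for some total order $\mathbf v$ on $V$, for every path from the root to a leaf, the sequence of variables labeling its internal nodes is a subsequence of $\mathbf v$ without duplicates. It captures the Boolean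 function mapping each valuation $\nu$ to the label of the leaf reached from the root by following $\nu$; it is an OBDD for $\varphi$ if it captures the function of $\varphi$. Its width is the maximum number of nodes at a level, where the level for a prefix of $\mathbf v$ is the set of nodes reached from the root by enumerating all possible valuations of this prefix. *)

theory Defs
  imports Complex_Main "HOL-Library.Sublist"
begin

datatype 'v monotone_nf =
    DNF (clauses: "'v set set")
  | CNF (clauses: "'v set set")

text \<open>Valuations are total on the type \<^typ>\<open>'v\<close>; only their values on the variables of the
  formula matter.\<close>

primrec nf_holds :: "('v \<Rightarrow> bool) \<Rightarrow> 'v monotone_nf \<Rightarrow> bool" where
  "nf_holds \<nu> (DNF C) \<longleftrightarrow> (\<exists>K\<in>C. \<forall>x\<in>K. \<nu> x)"
| "nf_holds \<nu> (CNF C) \<longleftrightarrow> (\<forall>K\<in>C. \<exists>x\<in>K. \<nu> x)"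

definition monotone_nf_on :: "'v set \<Rightarrow> 'v monotone_nf \<Rightarrow> bool" where
  "monotone_nf_on V \<phi> \<longleftrightarrow>
     finite V \<and>
     (\<forall>K\<in>clauses \<phi>. K \<subseteq> V) \<and>
     (\<forall>K\<in>clauses \<phi>. \<forall>L\<in>clauses \<phi>. K \<subseteq> L \<longrightarrow> K = L) \<and>
     (\<exists>K\<in>clauses \<phi>. K \<noteq> {})"

text \<open>A hypergraph is given by its vertices \<open>V\<close> and hyperedges \<open>E\<close>.\<close>

definition hyper_arity :: "'v set set \<Rightarrow> nat" where
  "hyper_arity E = Max (card ` E)"

definition hyper_degree :: "'v set \<Rightarrow> 'v set set \<Rightarrow> nat" where
  "hyper_degree V E = Max ((\<lambda>v. card {e \<in> E. v \<in> e}) ` V)"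

text \<open>The path is the list of its bags. A vertex that lies in no hyperedge may be missing from
  all bags; adding a singleton bag for it does not change the width once some hyperedge is
  non-empty.\<close>

definition path_decomposition :: "'v set \<Rightarrow> 'v set set \<Rightarrow> 'v set list \<Rightarrow> bool" where
  "path_decomposition V E bs \<longleftrightarrow>
     bs \<noteq> [] \<and>
     (\<forall>b\<in>set bs. b \<subseteq> V) \<and>
     (\<forall>e\<in>E. \<exists>b\<in>set bs. e \<subseteq> b) \<and>
     (\<forall>v\<in>V. \<forall>i j k. i \<le> j \<and> j \<le> k \<and> k < length bs \<and> v \<in> bs ! i \<and> v \<in> bs ! k \<longrightarrow> v \<in> bs ! j)"

text \<open>The subtraction does not truncate when some hyperedge is non-empty.\<close>

definition decomposition_width :: "'v set list \<Rightarrow> nat" where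
  "decomposition_width bs = Max (card ` set bs) - 1"

definition pathwidth :: "'v set \<Rightarrow> 'v set set \<Rightarrow> nat" where
  "pathwidth V E = (LEAST w. \<exists>bs. path_decomposition V E bs \<and> decomposition_width bs = w)"

text \<open>A node is a leaf with its label, or an internal node with its variable and the targets
  of its outgoing edges labeled 0 (\<^const>\<open>False\<close>) and 1 (\<^const>\<open>True\<close>).\<close>

datatype ('n, 'v) bdd_node =
    is_leaf: Leaf bool
  | Branch (branch_var: 'v) (branch_succ: "bool \<Rightarrow> 'n")

record ('n, 'v) bdd =
  bdd_nodes :: "'n set"
  bdd_root :: 'n
  bdd_node :: "'n \<Rightarrow> ('n, 'v) bdd_node"

definition bdd_edges :: "('n, 'v) bdd \<Rightarrow> ('n \<times> 'n) set" where
  "bdd_edges D =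
     {(u, w). u \<in> bdd_nodes D \<and> (\<exists>x s b. bdd_node D u = Branch x s \<and> w = s b)}"

definition rooted_dag :: "('n, 'v) bdd \<Rightarrow> bool" where
  "rooted_dag D \<longleftrightarrow>
     finite (bdd_nodes D) \<and>
     bdd_root D \<in> bdd_nodes D \<and>
     bdd_edges D \<subseteq> bdd_nodes D \<times> bdd_nodes D \<and>
     acyclic (bdd_edges D) \<and>
     (\<forall>u\<in>bdd_nodes D. (bdd_root D, u) \<in> (bdd_edges D)\<^sup>*)"

definition root_leaf_path :: "('n, 'v) bdd \<Rightarrow> 'n list \<Rightarrow> bool" where
  "root_leaf_path D us \<longleftrightarrow>
     us \<noteq> [] \<and> hd us = bdd_root D \<and>
     successively (\<lambda>u w. (u, w) \<in> bdd_edges D) us \<and>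
     is_leaf (bdd_node D (last us))"

text \<open>\<open>D\<close> is an OBDD on the variables \<open>V\<close> whose paths respect the total order on \<open>V\<close> given by
  the enumeration \<open>vs\<close>.\<close>

definition obdd_with_order :: "'v set \<Rightarrow> 'v list \<Rightarrow> ('n, 'v) bdd \<Rightarrow> bool" where
  "obdd_with_order V vs D \<longleftrightarrow>
     rooted_dag D \<and>
     (\<forall>u\<in>bdd_nodes D. \<not> is_leaf (bdd_node D u) \<longrightarrow> branch_var (bdd_node D u) \<in> V) \<and>
     distinct vs \<and> set vs = V \<and>
     (\<forall>us. root_leaf_path D us \<longrightarrow>
        (let xs = map (\<lambda>u. branch_var (bdd_node D u)) (butlast us)
         in subseq xs vs \<and> distinct xs))"

text \<open>\<open>reaches D P \<nu> u w\<close>: following from \<open>u\<close> the valuation \<open>\<nu>\<close> of the variables in \<open>P\<close> ends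
  in \<open>w\<close>, the first node that is a leaf or whose variable is not in \<open>P\<close>. Since OBDDs need not
  test every variable on every path, \<open>w\<close> need not be labeled with the next variable
  of the order.\<close>

inductive reaches :: "('n, 'v) bdd \<Rightarrow> 'v set \<Rightarrow> ('v \<Rightarrow> bool) \<Rightarrow> 'n \<Rightarrow> 'n \<Rightarrow> bool"
  for D P \<nu> where
  leaf: "bdd_node D u = Leaf b \<Longrightarrow> reaches D P \<nu> u u"
| unassigned: "bdd_node D u = Branch x s \<Longrightarrow> x \<notin> P \<Longrightarrow> reaches D P \<nu> u u"
| step: "bdd_node D u = Branch x s \<Longrightarrow> x \<in> P \<Longrightarrow> reaches D P \<nu> (s (\<nu> x)) w \<Longrightarrow> reaches D P \<nu> u w"

definition captures :: "'v set \<Rightarrow> ('n, 'v) bdd \<Rightarrow> (('v \<Rightarrow> bool) \<Rightarrow> bool) \<Rightarrow> bool" where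
  "captures V D f \<longleftrightarrow>
     (\<forall>\<nu>. \<exists>w. reaches D V \<nu> (bdd_root D) w \<and> bdd_node D w = Leaf (f \<nu>))"

definition obdd_level :: "('n, 'v) bdd \<Rightarrow> 'v list \<Rightarrow> 'n set" where
  "obdd_level D ps = {w. \<exists>\<nu>. reaches D (set ps) \<nu> (bdd_root D) w}"

definition obdd_width :: "'v list \<Rightarrow> ('n, 'v) bdd \<Rightarrow> nat" where
  "obdd_width vs D = Max ((\<lambda>ps. card (obdd_level D ps)) ` set (prefixes vs))"

text \<open>The minimum ranges over all orders as well as all diagrams. Diagrams are finite, so taking
  their nodes in \<^typ>\<open>nat\<close> is no restriction.\<close>

definition min_obdd_width :: "'v set \<Rightarrow> 'v monotone_nf \<Rightarrow> nat" where
  "min_obdd_width V \<phi> =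
     (LEAST w. \<exists>vs (D :: (nat, 'v) bdd).
        obdd_with_order V vs D \<and> captures V D (\<lambda>\<nu>. nf_holds \<nu> \<phi>) \<and> obdd_width vs D = w)"

end

theory Submission
  imports Defs
begin

text \<open>For a fixed variable order, the least width of an OBDD is the maximal number of subfunctions
  obtained by fixing the variables of a prefix. A subfunction of a DNF is determined by which of the
  clauses crossing the cut are still alive and by whether the formula is already satisfied; if the
  variables are ordered by the first bag of a path decomposition containing them, every crossing
  clause meets one bag, so there are \<open>2^O(pw)\<close> subfunctions. Conversely, any order yields a path
  decomposition whose bags are the unions of the clauses spanning a position, so some cut is crossed
  by \<open>\<Omega>(pw)\<close> clauses. Of these, \<open>\<Omega>(pw)\<close> can be chosen such that no clause meets two of
  them, and the subsets of the chosen clauses give pairwise different subfunctions. CNFs reduce to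
  DNFs by duality.\<close>

section \<open>Subfunctions and OBDD width\<close>

text \<open>A subfunction stays a function of total valuations: it ignores its argument on
  \<open>P\<close> instead of losing these variables. Subfunctions can thus be compared by plain
  equality.\<close>

definition subfunction :: "(('v \<Rightarrow> bool) \<Rightarrow> bool) \<Rightarrow> 'v set \<Rightarrow> ('v \<Rightarrow> bool) \<Rightarrow> ('v \<Rightarrow> bool) \<Rightarrow> bool" where
  "subfunction f P \<nu> = (\<lambda>\<mu>. f (override_on \<mu> \<nu> P))"

definition subfunctions :: "(('v \<Rightarrow> bool) \<Rightarrow> bool) \<Rightarrow> 'v set \<Rightarrow> (('v \<Rightarrow> bool) \<Rightarrow> bool) set" where
  "subfunctions f P = range (subfunction f P)"

definition depends_only_on :: "(('v \<Rightarrow> bool) \<Rightarrow> bool) \<Rightarrow> 'v set \<Rightarrow> bool" where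
  "depends_only_on f V \<longleftrightarrow> (\<forall>\<nu> \<mu>. (\<forall>x\<in>V. \<nu> x = \<mu> x) \<longrightarrow> f \<nu> = f \<mu>)"

lemma subfunction_empty [simp]: "subfunction f {} \<nu> = f"
  by (simp add: subfunction_def)

lemma subfunction_cong:
  assumes "\<And>x. x \<in> P \<Longrightarrow> \<nu> x = \<nu>' x"
  shows "subfunction f P \<nu> = subfunction f P \<nu>'"
proof -
  have "override_on \<mu> \<nu> P = override_on \<mu> \<nu>' P" for \<mu>
    using assms by (auto simp: override_on_def)
  then show ?thesis by (simp add: subfunction_def)
qed

text \<open>Fixing one more variable amounts to overwriting it in the argument. This makes the
  successors of a node in the diagram built below subfunctions again.\<close>

lemma subfunction_insert:
  "subfunction f (insert x P) \<nu> = (\<lambda>\<mu>. subfunction f P \<nu> (\<mu>(x := \<nu> x)))"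
proof -
  have "override_on \<mu> \<nu> (insert x P) = override_on (\<mu>(x := \<nu> x)) \<nu> P" for \<mu>
    by (auto simp: override_on_def)
  then show ?thesis by (simp add: subfunction_def)
qed

lemma finite_subfunctions:
  assumes "finite P"
  shows "finite (subfunctions f P)"
proof -
  have "subfunctions f P \<subseteq> (\<lambda>A. subfunction f P (\<lambda>x. x \<in> A)) ` Pow P"
  proof
    fix h assume "h \<in> subfunctions f P"
    then obtain \<nu> where "h = subfunction f P \<nu>" by (auto simp: subfunctions_def)
    also have "\<dots> = subfunction f P (\<lambda>x. x \<in> {x \<in> P. \<nu> x})"
      by (rule subfunction_cong) auto
    finally show "h \<in> (\<lambda>A. subfunction f P (\<lambda>x. x \<in> A)) ` Pow P" by blast
  qed
  then show ?thesis using assms by (meson finite_Pow_iff finite_imageI finite_subset)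
qed

text \<open>Negating all inputs and the output is an involution; it turns the subfunction of
  \<open>f\<close> for \<nu> into the subfunction of the dual for the complement of \<nu>, and so is
  a bijection between the two families.\<close>

lemma card_subfunctions_dual:
  "card (subfunctions (\<lambda>\<nu>. \<not> f (\<lambda>x. \<not> \<nu> x)) P) = card (subfunctions f P)"
proof -
  define d :: "(('a \<Rightarrow> bool) \<Rightarrow> bool) \<Rightarrow> ('a \<Rightarrow> bool) \<Rightarrow> bool"
    where "d = (\<lambda>h \<mu>. \<not> h (\<lambda>x. \<not> \<mu> x))"
  have dd: "d (d h) = h" for h by (simp add: d_def)
  have *: "d (subfunction f P \<nu>) = subfunction (d f) P (\<lambda>x. \<not> \<nu> x)" for f :: "('a \<Rightarrow> bool) \<Rightarrow> bool" and \<nu>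
  proof -
    have "(\<lambda>x. \<not> override_on \<mu> (\<lambda>x. \<not> \<nu> x) P x) = override_on (\<lambda>x. \<not> \<mu> x) \<nu> P" for \<mu>
      by (auto simp: override_on_def)
    then show ?thesis by (simp add: d_def subfunction_def)
  qed
  have sub: "d ` subfunctions f P \<subseteq> subfunctions (d f) P" for f :: "('a \<Rightarrow> bool) \<Rightarrow> bool"
    using * by (auto simp: subfunctions_def)
  \<comment> \<open>The reverse inclusion is the first one for \<open>d f\<close>, carried back by
    the involution.\<close>
  have "subfunctions (d f) P \<subseteq> d ` subfunctions f P"
    using sub[of "d f"] by (force simp: dd image_subset_iff image_iff)
  with sub[of f] have "subfunctions (d f) P = d ` subfunctions f P" by blast
  moreover have "inj_on d (subfunctions f P)" by (metis dd inj_onI)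
  ultimately have "card (subfunctions (d f) P) = card (subfunctions f P)"
    by (simp add: card_image)
  then show ?thesis by (simp add: d_def)
qed

section \<open>Runs and paths in a decision diagram\<close>

lemma reaches_deterministic:
  "reaches D P \<nu> u w \<Longrightarrow> reaches D P \<nu> u w' \<Longrightarrow> w = w'"
  by (induction rule: reaches.induct) (auto elim: reaches.cases)

lemma reaches_cong:
  "reaches D P \<nu> u w \<Longrightarrow> (\<And>x. x \<in> P \<Longrightarrow> \<nu> x = \<nu>' x) \<Longrightarrow> reaches D P \<nu>' u w"
  by (induction rule: reaches.induct) (auto intro: reaches.intros)

lemma reaches_subset_exists:
  "reaches D Q \<nu> u w \<Longrightarrow> P \<subseteq> Q \<Longrightarrow> \<exists>w'. reaches D P \<nu> u w'"
proof (induction rule: reaches.induct)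
  case (step u x s w)
  then show ?case by (cases "x \<in> P") (blast intro: reaches.intros)+
qed (blast intro: reaches.intros)+

text \<open>The run for the smaller set is an initial segment of the run for the larger one.\<close>

lemma reaches_continue:
  "reaches D P \<nu> u w \<Longrightarrow> reaches D Q \<nu> u l \<Longrightarrow> P \<subseteq> Q \<Longrightarrow> reaches D Q \<nu> w l"
proof (induction rule: reaches.induct)
  case (step u x s w)
  from step.prems(1) step.hyps step.prems(2) have "reaches D Q \<nu> (s (\<nu> x)) l"
    by (cases rule: reaches.cases) auto
  with step show ?case by blast
qed

lemma reaches_rtrancl:
  assumes "reaches D P \<nu> u w" "u \<in> bdd_nodes D" "bdd_edges D \<subseteq> bdd_nodes D \<times> bdd_nodes D"
  shows "(u, w) \<in> (bdd_edges D)\<^sup>* \<and> w \<in> bdd_nodes D"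
  using assms
proof (induction rule: reaches.induct)
  case (step u x s w)
  have e: "(u, s (\<nu> x)) \<in> bdd_edges D"
    using step by (auto simp: bdd_edges_def)
  with step show ?case by (blast intro: converse_rtrancl_into_rtrancl)
qed auto

lemma rtrancl_successively:
  assumes "(u, w) \<in> E\<^sup>*"
  obtains us where "us \<noteq> []" "hd us = u" "last us = w" "successively (\<lambda>u w. (u, w) \<in> E) us"
proof -
  from assms have "\<exists>us. us \<noteq> [] \<and> hd us = u \<and> last us = w \<and> successively (\<lambda>u w. (u, w) \<in> E) us"
  proof (induction rule: converse_rtrancl_induct)
    case base
    show ?case by (rule exI[of _ "[w]"]) simp
  next
    case (step u v)
    then obtain us where "us \<noteq> []" "hd us = v" "last us = w" "successively (\<lambda>u w. (u, w) \<in> E) us"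
      by blast
    with step.hyps show ?case
      by (intro exI[of _ "u # us"]) (simp add: successively_Cons)
  qed
  with that show ?thesis by blast
qed

text \<open>The occurrence of \<open>x\<close> must be matched inside \<open>qs\<close>, so all that
  follows it in the subsequence is matched there too. It serves to show that a path which has left
  the prefix of the order never tests a variable of the prefix again.\<close>

lemma subseq_append_disjoint:
  assumes "subseq (xs @ x # ys) (ps @ qs)" "x \<notin> set ps" "distinct (ps @ qs)"
  shows "set ys \<inter> set ps = {}"
proof -
  from list_emb_appendD[OF assms(1)] obtain as bs
    where ab: "ps @ qs = as @ bs" "subseq (x # ys) bs" by blast
  from list_emb_ConsD[OF ab(2)] obtain bs1 bs2 where b: "bs = bs1 @ x # bs2" "subseq ys bs2"
    by blast
  have ys: "set ys \<subseteq> set bs2" using list_emb_set[OF b(2)] by auto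
  have "set bs2 \<inter> set ps = {}"
  proof (rule ccontr)
    assume "\<not> ?thesis"
    then obtain y where y: "y \<in> set bs2" "y \<in> set ps" by blast
    have eq: "ps @ qs = (as @ bs1 @ [x]) @ bs2" using ab b by simp
    then obtain us where "ps = (as @ bs1 @ [x]) @ us \<or> qs = us @ bs2"
      unfolding append_eq_append_conv2 by blast
    then show False using assms(2,3) y by auto
  qed
  with ys show ?thesis by blast
qed

text \<open>All paths from \<open>u\<close> to a leaf count, not only those that follow one
  valuation, because the order condition on a diagram speaks of root-to-leaf paths. In this form the
  property passes to successors.\<close>

definition tests_none_after :: "('n, 'v) bdd \<Rightarrow> 'v set \<Rightarrow> 'n \<Rightarrow> bool" where
  "tests_none_after D P u \<longleftrightarrow>
     (\<forall>us. us \<noteq> [] \<and> hd us = u \<and> successively (\<lambda>u w. (u, w) \<in> bdd_edges D) us \<and>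
        is_leaf (bdd_node D (last us)) \<longrightarrow>
        (\<forall>v\<in>set (butlast us). branch_var (bdd_node D v) \<notin> P))"

text \<open>The run from \<open>u\<close> is itself a path to a leaf, so it tests only variables
  outside \<open>P\<close>, and there the two valuations agree.\<close>

lemma reaches_tests_none_after:
  assumes "reaches D Q \<kappa> u l" "is_leaf (bdd_node D l)" "u \<in> bdd_nodes D"
    and "bdd_edges D \<subseteq> bdd_nodes D \<times> bdd_nodes D"
    and "tests_none_after D P u"
    and "\<And>x. x \<notin> P \<Longrightarrow> \<kappa> x = \<kappa>' x"
  shows "reaches D Q \<kappa>' u l"
  using assms
proof (induction rule: reaches.induct)
  case (step u x s w)
  let ?v = "s (\<kappa> x)"
  have e: "(u, ?v) \<in> bdd_edges D"
    using step by (auto simp: bdd_edges_def)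
  then have v: "?v \<in> bdd_nodes D" using step.prems by blast
  \<comment> \<open>The rest of the run, as a path to a leaf; without such a path
    \<open>tests_none_after\<close> would say nothing about the variable of
    \<open>u\<close>.\<close>
  obtain us where us: "us \<noteq> []" "hd us = ?v" "last us = w"
      "successively (\<lambda>u w. (u, w) \<in> bdd_edges D) us"
    using reaches_rtrancl[OF step.hyps(3) v step.prems(3)] rtrancl_successively by metis
  have "branch_var (bdd_node D u) \<notin> P"
    using step.prems(4) us e step.prems(1) unfolding tests_none_after_def
    by (elim allE[of _ "u # us"]) (auto simp: successively_Cons)
  then have x: "\<kappa> x = \<kappa>' x" using step.hyps step.prems by simp
  have "tests_none_after D P ?v"
    unfolding tests_none_after_def
  proof (intro allI impI)
    fix us assume a: "us \<noteq> [] \<and> hd us = ?v \<and> successively (\<lambda>u w. (u, w) \<in> bdd_edges D) us \<and>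
        is_leaf (bdd_node D (last us))"
    then show "\<forall>v\<in>set (butlast us). branch_var (bdd_node D v) \<notin> P"
      using step.prems(4) e unfolding tests_none_after_def
      by (elim allE[of _ "u # us"]) (auto simp: successively_Cons)
  qed
  with step v have "reaches D Q \<kappa>' ?v w" by blast
  with step.hyps x show ?case by (simp add: reaches.step)
qed (auto intro: reaches.intros)

text \<open>A path from \<open>w\<close> to a leaf is extended backwards to the root and then
  respects the order. The run stopped at \<open>w\<close>, so \<open>w\<close> is a leaf or tests a
  variable outside the prefix; in the latter case every later test is also outside.\<close>

lemma level_tests_none_after:
  assumes o: "obdd_with_order V vs D" and ps: "prefix ps vs" and r: "reaches D (set ps) \<nu> (bdd_root D) w"
  shows "tests_none_after D (set ps) w"
  unfolding tests_none_after_def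
proof (intro allI impI)
  fix us assume a: "us \<noteq> [] \<and> hd us = w \<and> successively (\<lambda>u w. (u, w) \<in> bdd_edges D) us \<and>
        is_leaf (bdd_node D (last us))"
  then obtain us' where us: "us = w # us'" by (cases us) auto
  have dag: "rooted_dag D" and dist: "distinct vs" using o by (auto simp: obdd_with_order_def)
  from ps obtain qs where qs: "vs = ps @ qs" by (auto simp: prefix_def)
  have w: "is_leaf (bdd_node D w) \<or> branch_var (bdd_node D w) \<notin> set ps"
    using r by (induction rule: reaches.induct) auto
  show "\<forall>v\<in>set (butlast us). branch_var (bdd_node D v) \<notin> set ps"
  proof (cases "us' = []")
    case True
    then show ?thesis using us by simp
  next
    case False
    then have "(w, hd us') \<in> bdd_edges D" using a us by (simp add: successively_Cons)
    then have x: "branch_var (bdd_node D w) \<notin> set ps" using w by (auto simp: bdd_edges_def)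
    have "(bdd_root D, w) \<in> (bdd_edges D)\<^sup>*"
      using reaches_rtrancl[OF r] dag by (auto simp: rooted_dag_def)
    then obtain rs where rs: "rs \<noteq> []" "hd rs = bdd_root D" "last rs = w"
        "successively (\<lambda>u w. (u, w) \<in> bdd_edges D) rs"
      by (rule rtrancl_successively)
    have "root_leaf_path D (rs @ us')"
      using rs a us False by (auto simp: root_leaf_path_def successively_append_iff successively_Cons)
    moreover have "rs @ us' = butlast rs @ w # us'"
      using rs by (metis append.assoc append_Cons append_Nil append_butlast_last_id)
    ultimately have "subseq (map (\<lambda>u. branch_var (bdd_node D u)) (butlast rs @ w # butlast us')) vs"
      using o False unfolding obdd_with_order_def Let_def by (metis butlast.simps(2) butlast_append list.discI)
    then have "set (map (\<lambda>u. branch_var (bdd_node D u)) (butlast us')) \<inter> set ps = {}"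
      using x dist qs by (intro subseq_append_disjoint) auto
    with x show ?thesis using us False by auto
  qed
qed

text \<open>The node reached after the prefix determines the subfunction, so the level maps onto the
  set of subfunctions.\<close>

lemma card_subfunctions_le_obdd_width:
  assumes o: "obdd_with_order V vs D" and cap: "captures V D f" and ps: "prefix ps vs"
  shows "card (subfunctions f (set ps)) \<le> obdd_width vs D"
proof -
  let ?P = "set ps" and ?r = "bdd_root D"
  have dag: "rooted_dag D" and V: "set vs = V" using o by (auto simp: obdd_with_order_def)
  have sub: "?P \<subseteq> V" using ps V by (auto simp: prefix_def)
  have root: "?r \<in> bdd_nodes D" and edges: "bdd_edges D \<subseteq> bdd_nodes D \<times> bdd_nodes D"
    and fin: "finite (bdd_nodes D)" using dag by (auto simp: rooted_dag_def)
  have same: "subfunction f ?P \<nu> = subfunction f ?P \<nu>'"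
    if r: "reaches D ?P \<nu> ?r w" "reaches D ?P \<nu>' ?r w" for \<nu> \<nu>' w
  proof
    fix \<mu>
    define \<kappa> \<kappa>' where "\<kappa> = override_on \<mu> \<nu> ?P" and "\<kappa>' = override_on \<mu> \<nu>' ?P"
    obtain l l' where l: "reaches D V \<kappa> ?r l" "bdd_node D l = Leaf (f \<kappa>)"
      and l': "reaches D V \<kappa>' ?r l'" "bdd_node D l' = Leaf (f \<kappa>')"
      using cap by (meson captures_def)
    have "reaches D ?P \<kappa> ?r w" "reaches D ?P \<kappa>' ?r w"
      using r by (auto simp: \<kappa>_def \<kappa>'_def elim: reaches_cong)
    then have 1: "reaches D V \<kappa> w l" and 2: "reaches D V \<kappa>' w l'"
      using l l' sub by (auto intro: reaches_continue)
    \<comment> \<open>The two completions differ only on the prefix, which is not tested from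
      \<open>w\<close> on; hence both runs end in the same leaf.\<close>
    have "reaches D V \<kappa>' w l"
    proof (rule reaches_tests_none_after[OF 1])
      show "w \<in> bdd_nodes D" using reaches_rtrancl[OF r(1) root edges] by blast
      show "tests_none_after D ?P w" using level_tests_none_after[OF o ps r(1)] .
    qed (use l edges in \<open>auto simp: \<kappa>_def \<kappa>'_def\<close>)
    with 2 have "l = l'" by (rule reaches_deterministic[rotated])
    with l l' show "subfunction f ?P \<nu> \<mu> = subfunction f ?P \<nu>' \<mu>"
      by (simp add: subfunction_def \<kappa>_def \<kappa>'_def)
  qed
  let ?L = "obdd_level D ps"
  have "?L \<subseteq> bdd_nodes D"
    using reaches_rtrancl root edges unfolding obdd_level_def by fast
  then have finL: "finite ?L" using fin by (rule finite_subset)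
  \<comment> \<open>By \<open>same\<close>, it does not matter which valuation reaching
    \<open>w\<close> is chosen.\<close>
  define F where "F w = subfunction f ?P (SOME \<nu>. reaches D ?P \<nu> ?r w)" for w
  have "subfunctions f ?P \<subseteq> F ` ?L"
  proof
    fix h assume "h \<in> subfunctions f ?P"
    then obtain \<nu> where h: "h = subfunction f ?P \<nu>" by (auto simp: subfunctions_def)
    obtain w where w: "reaches D ?P \<nu> ?r w"
      using cap sub reaches_subset_exists unfolding captures_def by metis
    then have "reaches D ?P (SOME \<nu>. reaches D ?P \<nu> ?r w) ?r w"
      by (rule someI[where P = "\<lambda>\<nu>. reaches D ?P \<nu> ?r w"])
    then have "F w = h" unfolding F_def h using w by (rule same)
    with w show "h \<in> F ` ?L" by (auto simp: obdd_level_def)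
  qed
  then have "card (subfunctions f ?P) \<le> card ?L" using finL by (rule surj_card_le[rotated])
  also have "\<dots> \<le> obdd_width vs D"
    unfolding obdd_width_def using ps by (intro Max_ge) auto
  finally show ?thesis .
qed

text \<open>The nodes are the subfunctions, tagged with the length of the prefix that is fixed and
  encoded in the natural numbers.\<close>

lemma obdd_exists:
  assumes dist: "distinct vs" and V: "set vs = V" and f: "depends_only_on f V"
  obtains D :: "(nat, 'v) bdd"
  where "obdd_with_order V vs D" "captures V D f"
    "\<And>ps. prefix ps vs \<Longrightarrow> card (obdd_level D ps) \<le> card (subfunctions f (set ps))"
proof -
  define n where "n = length vs"
  \<comment> \<open>The tag keeps equal subfunctions at different depths apart. Every edge raises it
    by one, which gives acyclicity and the variable order.\<close>
  define cof where "cof i \<nu> = (i, subfunction f (set (take i vs)) \<nu>)" for i \<nu>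
  define N where "N = (\<Union>i\<le>n. range (cof i))"
  have "finite (range (cof i))" for i
  proof -
    have "range (cof i) = Pair i ` subfunctions f (set (take i vs))"
      by (auto simp: cof_def subfunctions_def)
    then show ?thesis by (simp add: finite_subfunctions)
  qed
  then have finN: "finite N" by (simp add: N_def)
  then obtain e :: "nat \<times> (('v \<Rightarrow> bool) \<Rightarrow> bool) \<Rightarrow> nat" where inj: "inj_on e N"
    using finite_imp_inj_to_nat_seg by metis
  define d where "d = inv_into N e"
  have cofN: "cof i \<nu> \<in> N" if "i \<le> n" for i \<nu> using that by (auto simp: N_def)
  have d: "d (e (cof i \<nu>)) = cof i \<nu>" if "i \<le> n" for i \<nu>
    unfolding d_def using inj cofN[OF that] by (rule inv_into_f_f)
  \<comment> \<open>At depth \<open>n\<close> all of \<open>V\<close> is fixed and the subfunction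
    is constant; it is read off at the all-\<open>False\<close> valuation. Every variable is tested
    on every path, even where the subfunction does not depend on it.\<close>
  define nd where "nd = (\<lambda>(i, h). if i < n
     then Branch (vs ! i) (\<lambda>b. e (Suc i, \<lambda>\<mu>. h (\<mu>(vs ! i := b))))
     else Leaf (h (\<lambda>_. False)))"
  define D :: "(nat, 'v) bdd"
    where "D = \<lparr>bdd_nodes = e ` N, bdd_root = e (cof 0 (\<lambda>_. False)), bdd_node = \<lambda>u. nd (d u)\<rparr>"
  \<comment> \<open>At depth 0 nothing is fixed, so all valuations share one node.\<close>
  have root: "bdd_root D = e (cof 0 \<nu>)" for \<nu> by (simp add: D_def cof_def)
  have "N = {cof i \<nu> |i \<nu>. i \<le> n}" unfolding N_def by blast
  then have nodes: "bdd_nodes D = {e (cof i \<nu>) |i \<nu>. i \<le> n}" unfolding D_def by (simp only: bdd.simps) blast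
  \<comment> \<open>Since \<open>vs ! i\<close> is not among the first \<open>i\<close> variables,
    changing \<nu> there leaves the current subfunction alone. The successor for \<open>b\<close> is
    therefore the node of the changed valuation.\<close>
  have upd: "(\<lambda>\<mu>. subfunction f (set (take i vs)) \<nu> (\<mu>(vs ! i := b))) =
      subfunction f (set (take (Suc i) vs)) (\<nu>(vs ! i := b))" if "i < n" for i \<nu> b
  proof -
    have new: "vs ! i \<notin> set (take i vs)"
      using dist that by (auto simp: n_def in_set_conv_nth nth_eq_iff_index_eq)
    have "set (take (Suc i) vs) = insert (vs ! i) (set (take i vs))"
      using that by (simp add: n_def take_Suc_conv_app_nth)
    moreover have "subfunction f (set (take i vs)) (\<nu>(vs ! i := b)) = subfunction f (set (take i vs)) \<nu>"
      using new by (intro subfunction_cong) auto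
    ultimately show ?thesis by (simp add: subfunction_insert)
  qed
  have branch: "bdd_node D (e (cof i \<nu>)) =
      Branch (vs ! i) (\<lambda>b. e (cof (Suc i) (\<nu>(vs ! i := b))))" if "i < n" for i \<nu>
    using that d[of i \<nu>] upd[OF that] by (simp add: D_def nd_def cof_def)
  have leaf: "bdd_node D (e (cof n \<nu>)) = Leaf (f \<nu>)" for \<nu>
  proof -
    have "f (override_on (\<lambda>_. False) \<nu> (set vs)) = f \<nu>"
      using f V by (auto simp: depends_only_on_def override_on_def)
    then show ?thesis
      using d[of n \<nu>] by (simp add: D_def nd_def cof_def n_def subfunction_def)
  qed
  have edgeD: "\<exists>i \<nu> b. i < n \<and> u = e (cof i \<nu>) \<and> w = e (cof (Suc i) (\<nu>(vs ! i := b)))"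
    if "(u, w) \<in> bdd_edges D" for u w
  proof -
    from that obtain x s b where u: "u \<in> bdd_nodes D" "bdd_node D u = Branch x s" "w = s b"
      by (auto simp: bdd_edges_def)
    then obtain i \<nu> where i: "i \<le> n" "u = e (cof i \<nu>)" by (auto simp: nodes)
    with u leaf[of \<nu>] have "i < n" by (cases "i = n") auto
    with u i branch[of i \<nu>] show ?thesis by auto
  qed
  have edgeI: "(e (cof i \<nu>), e (cof (Suc i) \<nu>)) \<in> bdd_edges D" if "i < n" for i \<nu>
    unfolding bdd_edges_def
    using that branch[OF that, of \<nu>] by (auto simp: nodes intro!: exI[of _ "\<nu> (vs ! i)"])
  define lev where "lev u = fst (d u)" for u
  have lev: "lev (e (cof i \<nu>)) = i" if "i \<le> n" for i \<nu>
    using d[OF that] by (simp add: lev_def cof_def)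
  have edge: "lev u < n \<and> lev w = Suc (lev u) \<and> branch_var (bdd_node D u) = vs ! lev u"
    if "(u, w) \<in> bdd_edges D" for u w
    using edgeD[OF that] by (auto simp: lev branch)
  have dag: "rooted_dag D"
    unfolding rooted_dag_def
  proof (intro conjI ballI)
    show "finite (bdd_nodes D)" using finN by (simp add: D_def)
    show "bdd_root D \<in> bdd_nodes D" using cofN[of 0] by (simp add: D_def)
    show "bdd_edges D \<subseteq> bdd_nodes D \<times> bdd_nodes D"
    proof (rule subrelI)
      fix u w assume "(u, w) \<in> bdd_edges D"
      from edgeD[OF this] obtain i \<nu> b where
        "i < n" "u = e (cof i \<nu>)" "w = e (cof (Suc i) (\<nu>(vs ! i := b)))" by blast
      then show "(u, w) \<in> bdd_nodes D \<times> bdd_nodes D"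
        unfolding nodes by (auto intro: Suc_leI less_imp_le)
    qed
    have "lev u < lev w" if "(u, w) \<in> (bdd_edges D)\<^sup>+" for u w
      using that by (induction rule: trancl_induct) (auto dest: edge)
    then show "acyclic (bdd_edges D)" by (auto simp: acyclic_def)
    fix u assume "u \<in> bdd_nodes D"
    then obtain i \<nu> where i: "i \<le> n" "u = e (cof i \<nu>)" by (auto simp: nodes)
    have "(e (cof 0 \<nu>), e (cof i \<nu>)) \<in> (bdd_edges D)\<^sup>*"
      using i(1)
    proof (induction i)
      case (Suc i)
      then show ?case using edgeI[of i \<nu>] by (simp add: rtrancl.rtrancl_into_rtrancl)
    qed simp
    then show "(bdd_root D, u) \<in> (bdd_edges D)\<^sup>*" using root[of \<nu>] i by simp
  qed
  \<comment> \<open>Depth rises by one along each edge, so the variables tested form a contiguous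
    segment of \<open>vs\<close>; the end of the path is not counted, whence
    \<open>length us - 1\<close>.\<close>
  have path: "map (\<lambda>u. branch_var (bdd_node D u)) (butlast us) = take (length us - 1) (drop (lev (hd us)) vs)"
    if "us \<noteq> []" "successively (\<lambda>u w. (u, w) \<in> bdd_edges D) us" for us
    using that
  proof (induction us)
    case (Cons u us)
    show ?case
    proof (cases "us = []")
      case False
      then have e: "(u, hd us) \<in> bdd_edges D" and IH: "map (\<lambda>u. branch_var (bdd_node D u)) (butlast us) =
          take (length us - 1) (drop (lev (hd us)) vs)"
        using Cons by (auto simp: successively_Cons)
      have "drop (lev u) vs = vs ! lev u # drop (Suc (lev u)) vs"
        using edge[OF e] by (simp add: n_def Cons_nth_drop_Suc)
      then show ?thesis using IH False edge[OF e] by (cases us) auto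
    qed simp
  qed simp
  have ord: "obdd_with_order V vs D"
    unfolding obdd_with_order_def
  proof (intro conjI ballI allI impI)
    fix u assume u: "u \<in> bdd_nodes D" "\<not> is_leaf (bdd_node D u)"
    then obtain i \<nu> where i: "i \<le> n" "u = e (cof i \<nu>)" by (auto simp: nodes)
    with u leaf[of \<nu>] have "i < n" by (cases "i = n") auto
    with i branch[of i \<nu>] show "branch_var (bdd_node D u) \<in> V" using V by (auto simp: n_def)
  next
    fix us assume "root_leaf_path D us"
    then have "map (\<lambda>u. branch_var (bdd_node D u)) (butlast us) = take (length us - 1) vs"
      using path[of us] root lev[of 0] by (auto simp: root_leaf_path_def)
    then show "let xs = map (\<lambda>u. branch_var (bdd_node D u)) (butlast us) in subseq xs vs \<and> distinct xs"
      using dist by (auto simp: Let_def take_is_prefix prefix_imp_subseq)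
  qed (use dag dist V in auto)
  \<comment> \<open>Downward induction on \<open>i\<close>: at depth \<open>k\<close> the run stops,
    either at a leaf or at the first variable beyond the prefix; at a smaller depth the tested
    variable is assigned.\<close>
  have reach: "reaches D (set (take k vs)) \<nu> (e (cof i \<nu>)) (e (cof k \<nu>))" if "i \<le> k" "k \<le> n" for i k \<nu>
    using that(1)
  proof (induction rule: inc_induct)
    case base
    show ?case
    proof (cases "k = n")
      case True
      then show ?thesis using leaf by (auto intro: reaches.leaf)
    next
      case False
      then have k: "k < n" using that by simp
      then have "vs ! k \<notin> set (take k vs)"
        using dist by (auto simp: n_def in_set_conv_nth nth_eq_iff_index_eq)
      then show ?thesis using branch[OF k] by (auto intro: reaches.unassigned)
    qed
  next
    case (step i)
    then have i: "i < n" "i < k" using that by auto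
    then have "vs ! i \<in> set (take k vs)"
      using that by (auto simp: n_def in_set_conv_nth intro!: exI[of _ i])
    then show ?case using branch[OF i(1), of \<nu>] step by (auto intro: reaches.step)
  qed
  have cap: "captures V D f"
    unfolding captures_def
  proof
    fix \<nu>
    have "reaches D V \<nu> (bdd_root D) (e (cof n \<nu>))"
      using reach[of 0 n \<nu>] root[of \<nu>] V by (simp add: n_def)
    with leaf show "\<exists>w. reaches D V \<nu> (bdd_root D) w \<and> bdd_node D w = Leaf (f \<nu>)" by blast
  qed
  have "card (obdd_level D ps) \<le> card (subfunctions f (set ps))" if "prefix ps vs" for ps
  proof -
    define k where "k = length ps"
    have k: "k \<le> n" "ps = take k vs"
      using that by (auto simp: k_def n_def prefix_length_le dest: prefix_length_le) (auto simp: prefix_def)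
    have "obdd_level D ps \<subseteq> (\<lambda>h. e (k, h)) ` subfunctions f (set ps)"
    proof
      fix w assume "w \<in> obdd_level D ps"
      then obtain \<nu> where "reaches D (set ps) \<nu> (bdd_root D) w" by (auto simp: obdd_level_def)
      then have "w = e (cof k \<nu>)"
        using reach[of 0 k \<nu>] k root[of \<nu>] by (metis le0 reaches_deterministic)
      then show "w \<in> (\<lambda>h. e (k, h)) ` subfunctions f (set ps)"
        using k by (auto simp: cof_def subfunctions_def)
    qed
    then show ?thesis by (meson surj_card_le finite_subfunctions finite_set)
  qed
  with ord cap that show ?thesis by blast
qed

section \<open>Subfunctions of monotone formulas\<close>

definition crossing :: "'v set set \<Rightarrow> 'v set \<Rightarrow> 'v set set" where
  "crossing C P = {K \<in> C. K \<inter> P \<noteq> {} \<and> \<not> K \<subseteq> P}"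

text \<open>A CNF is the dual of the DNF with the same clauses, so from here on it suffices to count
  for DNFs.\<close>

lemma card_subfunctions_nf:
  "card (subfunctions (\<lambda>\<nu>. nf_holds \<nu> \<phi>) P) =
   card (subfunctions (\<lambda>\<nu>. \<exists>K\<in>clauses \<phi>. \<forall>x\<in>K. \<nu> x) P)"
proof (cases \<phi>)
  case (CNF C)
  have "(\<lambda>\<nu>. nf_holds \<nu> \<phi>) = (\<lambda>\<nu>. \<not> (\<exists>K\<in>C. \<forall>x\<in>K. \<not> \<nu> x))" using CNF by auto
  then show ?thesis
    using card_subfunctions_dual[of "\<lambda>\<nu>. \<exists>K\<in>C. \<forall>x\<in>K. \<nu> x" P] CNF by simp
qed simp

text \<open>Clauses inside \<open>P\<close> contribute a single bit, namely whether one of them is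
  satisfied; clauses disjoint from \<open>P\<close> are unaffected; a crossing clause is either
  falsified or survives with its part outside \<open>P\<close>. The \<open>+ 1\<close> in the
  exponent is the bit.\<close>

lemma card_subfunctions_le_crossing:
  assumes "finite C"
  shows "card (subfunctions (\<lambda>\<nu>. \<exists>K\<in>C. \<forall>x\<in>K. \<nu> x) P) \<le> 2 ^ (card (crossing C P) + 1)"
proof -
  let ?f = "\<lambda>\<nu>. \<exists>K\<in>C. \<forall>x\<in>K. \<nu> x"
  \<comment> \<open>\<open>G\<close> rebuilds the subfunction from the set \<open>S\<close> of
    surviving crossing clauses and the bit \<open>b\<close>.\<close>
  define G where "G = (\<lambda>(S, b) \<mu>. b \<or> (\<exists>K\<in>S. \<forall>x\<in>K - P. \<mu> x) \<or>
    (\<exists>K\<in>C. K \<inter> P = {} \<and> (\<forall>x\<in>K. \<mu> x)))"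
  let ?A = "Pow (crossing C P) \<times> (UNIV :: bool set)"
  have fin: "finite (crossing C P)" using assms by (simp add: crossing_def)
  have "subfunctions ?f P \<subseteq> G ` ?A"
  proof
    fix h assume "h \<in> subfunctions ?f P"
    then obtain \<nu> where h: "h = subfunction ?f P \<nu>" by (auto simp: subfunctions_def)
    define S where "S = {K \<in> crossing C P. \<forall>x\<in>K \<inter> P. \<nu> x}"
    define b where "b \<longleftrightarrow> (\<exists>K\<in>C. K \<subseteq> P \<and> (\<forall>x\<in>K. \<nu> x))"
    have eq: "(\<forall>x\<in>K. override_on \<mu> \<nu> P x) \<longleftrightarrow> (\<forall>x\<in>K \<inter> P. \<nu> x) \<and> (\<forall>x\<in>K - P. \<mu> x)" for K \<mu>
      by (auto simp: override_on_def)
    have "h \<mu> = G (S, b) \<mu>" for \<mu>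
    proof -
      have "h \<mu> \<longleftrightarrow> (\<exists>K\<in>C. (\<forall>x\<in>K \<inter> P. \<nu> x) \<and> (\<forall>x\<in>K - P. \<mu> x))"
        by (simp only: h subfunction_def eq)
      also have "\<dots> \<longleftrightarrow> G (S, b) \<mu>"
      proof
        assume "\<exists>K\<in>C. (\<forall>x\<in>K \<inter> P. \<nu> x) \<and> (\<forall>x\<in>K - P. \<mu> x)"
        then obtain K where K: "K \<in> C" "\<forall>x\<in>K \<inter> P. \<nu> x" "\<forall>x\<in>K - P. \<mu> x" by blast
        consider "K \<subseteq> P" | "K \<inter> P = {}" | "K \<in> crossing C P" using K by (auto simp: crossing_def)
        then show "G (S, b) \<mu>"
        proof cases
          case 1 with K have b unfolding b_def by blast
          then show ?thesis by (simp add: G_def)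
        next
          case 2 with K have "\<forall>x\<in>K. \<mu> x" by blast
          with 2 K show ?thesis by (auto simp: G_def)
        next
          case 3 with K have "K \<in> S" by (simp add: S_def)
          with K show ?thesis by (auto simp: G_def)
        qed
      next
        assume "G (S, b) \<mu>"
        then consider b | K where "K \<in> S" "\<forall>x\<in>K - P. \<mu> x" | K where "K \<in> C" "K \<inter> P = {}" "\<forall>x\<in>K. \<mu> x"
          by (auto simp: G_def)
        then show "\<exists>K\<in>C. (\<forall>x\<in>K \<inter> P. \<nu> x) \<and> (\<forall>x\<in>K - P. \<mu> x)"
        proof cases
          case 1 then show ?thesis unfolding b_def by blast
        next
          case 2 then show ?thesis by (auto simp: S_def crossing_def)
        next
          case 3 then show ?thesis by blast
        qed
      qed
      finally show ?thesis .
    qed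
    then have "h = G (S, b)" by blast
    moreover have "(S, b) \<in> ?A" by (auto simp: S_def)
    ultimately show "h \<in> G ` ?A" by (rule image_eqI)
  qed
  then have "card (subfunctions ?f P) \<le> card ?A" using fin by (intro surj_card_le) auto
  also have "\<dots> = 2 ^ (card (crossing C P) + 1)"
    using fin by (simp add: card_cartesian_product card_Pow)
  finally show ?thesis .
qed

section \<open>Many subfunctions from unlinked crossing clauses\<close>

text \<open>Clauses that share a variable are linked through one of the two. Pairwise unlinked
  clauses thus form the hypergraph analogue of an induced matching.\<close>

definition linked :: "'v set set \<Rightarrow> 'v set \<Rightarrow> 'v set \<Rightarrow> bool" where
  "linked C K K' \<longleftrightarrow> (\<exists>L\<in>C. L \<inter> K \<noteq> {} \<and> L \<inter> K' \<noteq> {})"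

text \<open>A set \<open>T\<close> of chosen clauses is encoded by making exactly the variables of
  its clauses true inside \<open>P\<close>. Evaluating the resulting subfunction at the indicator of
  a chosen clause \<open>K\<close> reveals whether \<open>K\<close> belongs to \<open>T\<close>, so
  different \<open>T\<close> give different subfunctions.\<close>

lemma subfunctions_ge_unlinked_crossing:
  assumes finP: "finite P" and antichain: "\<And>K L. K \<in> C \<Longrightarrow> L \<in> C \<Longrightarrow> K \<subseteq> L \<Longrightarrow> K = L"
    and ne: "{} \<notin> C" and S: "S \<subseteq> crossing C P" and finS: "finite S"
    and unlinked: "\<And>K K'. K \<in> S \<Longrightarrow> K' \<in> S \<Longrightarrow> linked C K K' \<Longrightarrow> K = K'"
  shows "2 ^ card S \<le> card (subfunctions (\<lambda>\<nu>. \<exists>K\<in>C. \<forall>x\<in>K. \<nu> x) P)"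
proof -
  let ?f = "\<lambda>\<nu>. \<exists>K\<in>C. \<forall>x\<in>K. \<nu> x"
  define F where "F T = subfunction ?f P (\<lambda>x. x \<in> \<Union>T)" for T
  have SC: "K \<in> C" "K \<inter> P \<noteq> {}" "\<not> K \<subseteq> P" if "K \<in> S" for K
    using S that by (auto simp: crossing_def)
  have F: "F T (\<lambda>x. x \<in> K) \<longleftrightarrow> K \<in> T" if T: "T \<subseteq> S" and K: "K \<in> S" for T K
  proof
    assume "K \<in> T"
    then have "\<forall>x\<in>K. override_on (\<lambda>x. x \<in> K) (\<lambda>x. x \<in> \<Union>T) P x" by (auto simp: override_on_def)
    then show "F T (\<lambda>x. x \<in> K)" using SC(1)[OF K] by (auto simp: F_def subfunction_def)
  next
    assume "F T (\<lambda>x. x \<in> K)"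
    then obtain L where L: "L \<in> C" and "\<forall>x\<in>L. override_on (\<lambda>x. x \<in> K) (\<lambda>x. x \<in> \<Union>T) P x"
      by (auto simp: F_def subfunction_def)
    then have sub: "(x \<in> P \<and> (\<exists>K'\<in>T. x \<in> K')) \<or> (x \<notin> P \<and> x \<in> K)" if "x \<in> L" for x
      using that by (cases "x \<in> P") (auto simp: override_on_def)
    show "K \<in> T"
    proof (rule ccontr)
      assume KT: "K \<notin> T"
      obtain x where x: "x \<in> L" using L ne by (metis ex_in_conv)
      have "\<exists>K'\<in>S. x \<in> K'" using sub[OF x] T K by blast
      then obtain K' where K': "K' \<in> S" "x \<in> K'" by blast
      \<comment> \<open>\<open>L\<close> meets only one element of \<open>S\<close>, hence equals it by minimality; but \<open>L\<close> then
        lies on one side of the cut, so it does not cross.\<close>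
      have one: "K'' = K'" if "K'' \<in> S" "y \<in> L" "y \<in> K''" for K'' y
        using unlinked[OF that(1) K'(1)] L x K' that by (auto simp: linked_def)
      have "y \<in> K'" if "y \<in> L" for y
        using sub[OF that] one[OF _ that] T K by blast
      then have LK': "L = K'" using antichain[OF L SC(1)[OF K'(1)]] by blast
      \<comment> \<open>If \<open>K' = K\<close>, a variable of \<open>L\<close> inside
        \<open>P\<close> lies in an element of \<open>T\<close>, which can only be \<open>K\<close>.
        Otherwise a variable of \<open>L\<close> outside \<open>P\<close> lies in \<open>K\<close>,
        so \<open>L\<close> links \<open>K\<close> and \<open>K'\<close>.\<close>
      show False
      proof (cases "K' = K")
        case True
        then obtain y where "y \<in> L" "y \<in> P" using SC(2)[OF K] LK' by blast
        with sub[of y] one[of _ y] T KT True show False by blast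
      next
        case False
        then obtain y where "y \<in> L" "y \<notin> P" using SC(3)[OF K'(1)] LK' by blast
        with sub[of y] one[of K y] K False show False by blast
      qed
    qed
  qed
  have "inj_on F (Pow S)"
  proof (rule inj_onI)
    fix T T' assume "T \<in> Pow S" "T' \<in> Pow S" "F T = F T'"
    then show "T = T'" using F[of T] F[of T'] by auto
  qed
  moreover have "F ` Pow S \<subseteq> subfunctions ?f P" by (auto simp: F_def subfunctions_def)
  ultimately have "card (Pow S) \<le> card (subfunctions ?f P)"
    by (intro card_inj_on_le[of F]) (auto simp: finite_subfunctions finP)
  then show ?thesis using finS by (simp add: card_Pow)
qed

section \<open>Hypergraphs\<close>

text \<open>The usual bound for independent sets in graphs of bounded degree: the neighbourhoods of
  a maximal one cover \<open>A\<close>. By reflexivity each neighbourhood contains its centre, hence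
  the factor \<open>d\<close> and not \<open>d + 1\<close>.\<close>

lemma independent_subset_exists:
  assumes fin: "finite A" and refl: "\<And>a. a \<in> A \<Longrightarrow> R a a"
    and symm: "\<And>a b. R a b \<Longrightarrow> R b a"
    and deg: "\<And>a. a \<in> A \<Longrightarrow> card {b \<in> A. R a b} \<le> d"
  obtains S where "S \<subseteq> A" "\<And>a b. a \<in> S \<Longrightarrow> b \<in> S \<Longrightarrow> R a b \<Longrightarrow> a = b" "card A \<le> card S * d"
proof -
  let ?I = "{S \<in> Pow A. \<forall>a\<in>S. \<forall>b\<in>S. R a b \<longrightarrow> a = b}"
  have "finite ?I" using fin by simp
  moreover have "{} \<in> ?I" by simp
  ultimately obtain S where S: "S \<in> ?I" and max: "\<And>T. T \<in> ?I \<Longrightarrow> S \<subseteq> T \<Longrightarrow> S = T"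
    by (metis (no_types, lifting) empty_iff finite_has_maximal)
  \<comment> \<open>by maximality, every element of \<open>A\<close> is related to some element of \<open>S\<close>\<close>
  have "A \<subseteq> (\<Union>a\<in>S. {b \<in> A. R a b})"
  proof
    fix b assume b: "b \<in> A"
    show "b \<in> (\<Union>a\<in>S. {b \<in> A. R a b})"
    proof (rule ccontr)
      assume n: "\<not> ?thesis"
      then have "insert b S \<in> ?I" using S b symm by auto
      then have "S = insert b S" by (rule max) auto
      with n b refl show False by blast
    qed
  qed
  moreover have finS: "finite S" using S fin by (auto intro: finite_subset)
  ultimately have "card A \<le> card (\<Union>a\<in>S. {b \<in> A. R a b})"
    using fin by (intro card_mono) auto
  also have "\<dots> \<le> (\<Sum>a\<in>S. card {b \<in> A. R a b})" using finS by (rule card_UN_le)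
  also have "\<dots> \<le> card S * d"
    using sum_bounded_above[of S "\<lambda>a. card {b \<in> A. R a b}" d] S deg by auto
  finally show ?thesis using that S by blast
qed

lemma card_UN_le_mult:
  assumes "finite I" "card I \<le> m" "\<And>i. i \<in> I \<Longrightarrow> card (A i) \<le> n"
  shows "card (\<Union>i\<in>I. A i) \<le> m * n"
proof -
  have "card (\<Union>i\<in>I. A i) \<le> (\<Sum>i\<in>I. card (A i))" using assms(1) by (rule card_UN_le)
  also have "\<dots> \<le> card I * n"
    using sum_bounded_above[of I "\<lambda>i. card (A i)" n] assms by auto
  also have "\<dots> \<le> m * n" using assms by simp
  finally show ?thesis .
qed

section \<open>Hypergraphs of bounded arity and degree\<close>

locale bounded_hypergraph =
  fixes V :: "'v set" and C :: "'v set set" and c :: nat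
  assumes finV: "finite V" and C_subset: "\<And>K. K \<in> C \<Longrightarrow> K \<subseteq> V"
    and antichain: "\<And>K L. K \<in> C \<Longrightarrow> L \<in> C \<Longrightarrow> K \<subseteq> L \<Longrightarrow> K = L"
    and C_nonempty: "C \<noteq> {}" and empty_notin: "{} \<notin> C"
    and arity: "\<And>K. K \<in> C \<Longrightarrow> card K \<le> c"
    and degree: "\<And>v. v \<in> V \<Longrightarrow> card {K \<in> C. v \<in> K} \<le> c"
begin

lemma finC: "finite C"
  using C_subset finV by (meson PowI finite_Pow_iff finite_subset subsetI)

lemma card_meeting:
  assumes "B \<subseteq> V" "card B \<le> m"
  shows "card {L \<in> C. L \<inter> B \<noteq> {}} \<le> m * c"
proof -
  have "{L \<in> C. L \<inter> B \<noteq> {}} = (\<Union>v\<in>B. {K \<in> C. v \<in> K})" by auto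
  also have "card \<dots> \<le> m * c"
    using assms finV by (intro card_UN_le_mult) (auto intro: finite_subset degree)
  finally show ?thesis .
qed

text \<open>Linked clauses are two steps apart: \<open>K\<close> meets at most \<open>c * c\<close>
  clauses, and each of these meets at most \<open>c * c\<close>.\<close>

lemma card_linked:
  assumes "K \<in> C"
  shows "card {K' \<in> C. linked C K K'} \<le> c ^ 4"
proof -
  have "{K' \<in> C. linked C K K'} = (\<Union>L\<in>{L \<in> C. L \<inter> K \<noteq> {}}. {K' \<in> C. K' \<inter> L \<noteq> {}})"
    by (auto simp: linked_def)
  also have "card \<dots> \<le> (c * c) * (c * c)"
    using assms finC by (intro card_UN_le_mult card_meeting) (auto simp: C_subset arity)
  finally show ?thesis by (simp add: power4_eq_xxxx mult.assoc)
qed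

lemma pathwidth_attained:
  obtains bs where "path_decomposition V C bs" "\<And>b. b \<in> set bs \<Longrightarrow> card b \<le> pathwidth V C + 1"
proof -
  \<comment> \<open>The one-bag decomposition shows that the minimum is over a non-empty
    set.\<close>
  have "path_decomposition V C [V]" using C_subset by (auto simp: path_decomposition_def)
  then have "\<exists>w bs. path_decomposition V C bs \<and> decomposition_width bs = w" by blast
  then have "\<exists>bs. path_decomposition V C bs \<and> decomposition_width bs = pathwidth V C"
    unfolding pathwidth_def by (rule LeastI_ex)
  then obtain bs where bs: "path_decomposition V C bs" "decomposition_width bs = pathwidth V C"
    by blast
  \<comment> \<open>Despite truncated subtraction, \<open>Max - 1 = w\<close> still yields
    \<open>Max \<le> w + 1\<close>.\<close>
  have "card b \<le> pathwidth V C + 1" if "b \<in> set bs" for b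
    proof -
    have "card b \<le> Max (card ` set bs)" using that by (intro Max_ge) auto
    then show ?thesis using bs(2) by (simp add: decomposition_width_def)
  qed
  with bs that show ?thesis by blast
qed

section \<open>Path decompositions and variable orders\<close>

text \<open>The bag at a position is the union of the clauses whose span in the order includes it.
  Such a clause contains the variable at this position or crosses the cut just before it, so there
  are at most \<open>c + m\<close> of them, each with at most \<open>c\<close> variables.\<close>

lemma pathwidth_le_crossing:
  assumes dist: "distinct vs" and V: "set vs = V"
    and cross: "\<And>i. card (crossing C (set (take i vs))) \<le> m"
  shows "pathwidth V C \<le> c * (c + m)"
proof -
  define n where "n = length vs"
  \<comment> \<open>Both parts of the order contain position \<open>i\<close>, so a clause belongs
    to \<open>T i\<close> for the position of each of its variables.\<close>
  define T where "T i = {K \<in> C. K \<inter> set (take (Suc i) vs) \<noteq> {} \<and> K \<inter> set (drop i vs) \<noteq> {}}" for i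
  define bs where "bs = map (\<lambda>i. \<Union>(T i)) [0..<n]"
  obtain K v where "K \<in> C" "v \<in> K" using C_nonempty empty_notin by (metis ex_in_conv)
  then have "v \<in> set vs" using C_subset V by blast
  then have n: "n > 0" by (auto simp: n_def)
  have pd: "path_decomposition V C bs"
    unfolding path_decomposition_def
  proof (intro conjI ballI allI impI)
    show "bs \<noteq> []" using n by (simp add: bs_def)
  next
    fix b assume "b \<in> set bs" then show "b \<subseteq> V" using C_subset by (fastforce simp: bs_def T_def)
  next
    fix K assume K: "K \<in> C"
    then obtain v where v: "v \<in> K" using empty_notin by (metis ex_in_conv)
    then obtain i where i: "i < n" "v = vs ! i"
      using K C_subset V by (metis in_set_conv_nth n_def subset_iff)
    have "v \<in> set (take (Suc i) vs)" "v \<in> set (drop i vs)"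
      using i by (auto simp: n_def take_Suc_conv_app_nth Cons_nth_drop_Suc[symmetric])
    then have "K \<in> T i" using K v by (auto simp: T_def)
    then show "\<exists>b\<in>set bs. K \<subseteq> b" using i by (auto simp: bs_def)
  next
    fix v i j k assume "v \<in> V" and a: "i \<le> j \<and> j \<le> k \<and> k < length bs \<and> v \<in> bs ! i \<and> v \<in> bs ! k"
    then obtain K L where K: "K \<in> T i" "v \<in> K" and L: "L \<in> T k" "v \<in> L" by (auto simp: bs_def)
    have "v \<in> set (take j vs @ drop j vs)" using \<open>v \<in> V\<close> V by simp
    \<comment> \<open>If \<open>v\<close> is at position \<open>j\<close> or later, the clause that
      put \<open>v\<close> into bag \<open>i\<close> spans from at most \<open>i\<close> to
      \<open>v\<close>, hence over \<open>j\<close>; if \<open>v\<close> comes earlier, the clause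
      from bag \<open>k\<close> does.\<close>
    then consider "v \<in> set (drop j vs)" | "v \<in> set (take j vs)" by (auto simp del: append_take_drop_id)
    then have "\<exists>M. M \<in> T j \<and> v \<in> M"
    proof cases
      case 1
      have "set (take (Suc i) vs) \<subseteq> set (take (Suc j) vs)" using a by (simp add: set_take_subset_set_take)
      with 1 K have "K \<in> T j" by (auto simp: T_def)
      with K show ?thesis by blast
    next
      case 2
      have "set (drop k vs) \<subseteq> set (drop j vs)" using a by (simp add: set_drop_subset_set_drop)
      moreover have "set (take j vs) \<subseteq> set (take (Suc j) vs)" by (simp add: set_take_subset_set_take)
      ultimately have "L \<in> T j" using 2 L by (auto simp: T_def)
      with L show ?thesis by blast
    qed
    then show "v \<in> bs ! j" using a by (auto simp: bs_def)
  qed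
  have "card b \<le> c * (c + m)" if "b \<in> set bs" for b
  proof -
    from that obtain i where i: "i < n" "b = \<Union>(T i)" by (auto simp: bs_def)
    have vi: "vs ! i \<in> V" using i V by (auto simp: n_def)
    have "T i \<subseteq> {K \<in> C. vs ! i \<in> K} \<union> crossing C (set (take i vs))"
    proof
      fix K assume K: "K \<in> T i"
      have "set (take (Suc i) vs) = insert (vs ! i) (set (take i vs))"
        using i by (simp add: n_def take_Suc_conv_app_nth)
      moreover have "set (take i vs) \<inter> set (drop i vs) = {}"
        using dist by (metis append_take_drop_id distinct_append)
      ultimately show "K \<in> {K \<in> C. vs ! i \<in> K} \<union> crossing C (set (take i vs))"
        using K by (auto simp: T_def crossing_def)
    qed
    then have "card (T i) \<le> card ({K \<in> C. vs ! i \<in> K} \<union> crossing C (set (take i vs)))"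
      using finC by (intro card_mono) (auto simp: crossing_def)
    also have "\<dots> \<le> c + m"
      using degree[OF vi] cross[of i] card_Un_le[of "{K \<in> C. vs ! i \<in> K}" "crossing C (set (take i vs))"]
      by linarith
    finally have "card (\<Union>K\<in>T i. K) \<le> (c + m) * c"
      using finC arity by (intro card_UN_le_mult) (auto simp: T_def)
    then show ?thesis using i by (simp add: mult.commute)
  qed
  then have "Max (card ` set bs) \<le> c * (c + m)"
    using n by (subst Max_le_iff) (auto simp: bs_def)
  then have "decomposition_width bs \<le> c * (c + m)" by (simp add: decomposition_width_def)
  moreover have "pathwidth V C \<le> decomposition_width bs"
    unfolding pathwidth_def using pd by (intro Least_le) blast
  ultimately show ?thesis by simp
qed

text \<open>Variables are sorted by the first bag that contains them. If \<open>i\<close> is the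
  first bag of the last variable of a prefix, every clause crossing the cut meets bag
  \<open>i\<close>, and a bag of \<open>pathwidth V C + 1\<close> variables of degree at most
  \<open>c\<close> meets few clauses.\<close>

lemma order_with_few_crossing:
  obtains vs where "distinct vs" "set vs = V"
    "\<And>ps. prefix ps vs \<Longrightarrow> card (crossing C (set ps)) \<le> (pathwidth V C + 1) * c"
proof -
  obtain bs where bs: "path_decomposition V C bs" and card_bs: "\<And>b. b \<in> set bs \<Longrightarrow> card b \<le> pathwidth V C + 1"
    using pathwidth_attained by blast
  \<comment> \<open>A variable in no bag lies in no clause. It gets 0, a valid index as
    \<open>bs\<close> is non-empty, so that \<open>bs ! first v\<close> is a bag for every
    \<open>v\<close>.\<close>
  define first where "first v = (if v \<in> \<Union>(set bs) then LEAST i. i < length bs \<and> v \<in> bs ! i else 0)" for v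
  have first: "first v < length bs" "v \<in> \<Union>(set bs) \<Longrightarrow> v \<in> bs ! first v" for v
  proof -
    have "first v < length bs \<and> v \<in> bs ! first v" if "v \<in> \<Union>(set bs)"
    proof -
      have "\<exists>i. i < length bs \<and> v \<in> bs ! i" using that by (auto simp: in_set_conv_nth)
      then show ?thesis using that LeastI_ex[of "\<lambda>i. i < length bs \<and> v \<in> bs ! i"] by (simp add: first_def)
    qed
    moreover have "bs \<noteq> []" using bs by (simp add: path_decomposition_def)
    ultimately show "first v < length bs" "v \<in> \<Union>(set bs) \<Longrightarrow> v \<in> bs ! first v"
      by (cases "v \<in> \<Union>(set bs)"; auto simp: first_def)+
  qed
  have first_le: "first v \<le> j" if "j < length bs" "v \<in> bs ! j" for v j
    unfolding first_def using that by (auto intro: Least_le)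
  obtain us where us: "set us = V" "distinct us" using finV finite_distinct_list by blast
  define vs where "vs = sort_key first us"
  have vs: "distinct vs" "set vs = V" "sorted (map first vs)" using us by (auto simp: vs_def)
  have "card (crossing C (set ps)) \<le> (pathwidth V C + 1) * c" if ps: "prefix ps vs" for ps
  proof (cases "ps = []")
    case True
    then show ?thesis by (simp add: crossing_def)
  next
    case False
    then obtain as x where ps_eq: "ps = as @ [x]" by (metis rev_exhaust)
    define i where "i = first x"
    from ps obtain qs where qs: "vs = ps @ qs" by (auto simp: prefix_def)
    have "sorted (map first (as @ [x] @ qs))" using vs(3) by (simp add: qs ps_eq)
    then have ps_le: "\<And>z. z \<in> set ps \<Longrightarrow> first z \<le> i" and qs_ge: "\<And>y. y \<in> set qs \<Longrightarrow> i \<le> first y"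
      by (auto simp: sorted_append i_def ps_eq)
    have "crossing C (set ps) \<subseteq> {L \<in> C. L \<inter> bs ! i \<noteq> {}}"
    proof
      fix K assume "K \<in> crossing C (set ps)"
      then obtain z y where K: "K \<in> C" and z: "z \<in> K" "z \<in> set ps" and y: "y \<in> K" "y \<notin> set ps"
        by (auto simp: crossing_def)
      then have "y \<in> V" "z \<in> V" using C_subset by auto
      with y have yq: "y \<in> set qs" using vs(2) qs by auto
      obtain j where j: "j < length bs" "K \<subseteq> bs ! j"
        using bs K unfolding path_decomposition_def by (metis in_set_conv_nth)
      \<comment> \<open>The bag \<open>j\<close> containing \<open>K\<close> contains
        \<open>y\<close>, whose first bag is not before \<open>i\<close>. As \<open>z\<close> occurs
        in a bag up to \<open>i\<close> and again in bag \<open>j\<close>, connectedness puts it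
        into bag \<open>i\<close>.\<close>
      have "i \<le> j" using qs_ge[OF yq] first_le[OF j(1)] j y by (meson le_trans subset_iff)
      moreover have "z \<in> bs ! first z" using j z by (intro first) (auto intro: nth_mem)
      moreover have "first z \<le> i" using ps_le z by blast
      ultimately have "z \<in> bs ! i"
        using bs \<open>z \<in> V\<close> j z unfolding path_decomposition_def
        by (metis (no_types, lifting) subset_iff)
      with K z show "K \<in> {L \<in> C. L \<inter> bs ! i \<noteq> {}}" by blast
    qed
    then have "card (crossing C (set ps)) \<le> card {L \<in> C. L \<inter> bs ! i \<noteq> {}}"
      using finC by (intro card_mono) auto
    also have "\<dots> \<le> (pathwidth V C + 1) * c"
    proof (rule card_meeting)
      have "bs ! i \<in> set bs" using first(1) by (simp add: i_def)
      then show "bs ! i \<subseteq> V" "card (bs ! i) \<le> pathwidth V C + 1"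
        using bs card_bs by (auto simp: path_decomposition_def)
    qed
    finally show ?thesis .
  qed
  with vs that show ?thesis by blast
qed

text \<open>At the cut with the most crossing clauses, their number bounds the pathwidth; a maximal
  unlinked choice among them loses only a factor \<open>c ^ 4\<close> and yields
  \<open>2 ^ r\<close> subfunctions.\<close>

lemma order_has_many_subfunctions:
  assumes dist: "distinct vs" and V: "set vs = V"
  obtains i r where "2 ^ r \<le> card (subfunctions (\<lambda>\<nu>. \<exists>K\<in>C. \<forall>x\<in>K. \<nu> x) (set (take i vs)))"
    "pathwidth V C \<le> c * (c + r * c ^ 4)"
proof -
  \<comment> \<open>Here \<open>i\<close> ranges over all naturals; the maximum exists because the
    counts never exceed \<open>card C\<close>.\<close>
  let ?m = "\<lambda>i. card (crossing C (set (take i vs)))"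
  have "?m i \<le> card C" for i
    using finC by (intro card_mono) (auto simp: crossing_def)
  then have "finite (range ?m)" by (auto intro: finite_subset[of _ "{..card C}"])
  then have "Max (range ?m) \<in> range ?m" by (intro Max_in) auto
  then obtain i where "?m i = Max (range ?m)" by force
  then have i: "?m k \<le> ?m i" for k using \<open>finite (range ?m)\<close> by simp
  let ?X = "crossing C (set (take i vs))"
  have X: "?X \<subseteq> C" "finite ?X" using finC by (auto simp: crossing_def)
  obtain S where S: "S \<subseteq> ?X" "\<And>K L. K \<in> S \<Longrightarrow> L \<in> S \<Longrightarrow> linked C K L \<Longrightarrow> K = L"
    "card ?X \<le> card S * c ^ 4"
  proof (rule independent_subset_exists[of ?X "linked C" "c ^ 4"])
    show "linked C K K" if "K \<in> ?X" for K using that by (auto simp: linked_def crossing_def)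
    show "linked C L K" if "linked C K L" for K L using that by (auto simp: linked_def)
    show "card {L \<in> ?X. linked C K L} \<le> c ^ 4" if "K \<in> ?X" for K
    proof -
      have "card {L \<in> ?X. linked C K L} \<le> card {L \<in> C. linked C K L}"
        using X finC by (intro card_mono) auto
      also have "\<dots> \<le> c ^ 4" using that X by (intro card_linked) auto
      finally show ?thesis .
    qed
  qed (use X in auto)
  show ?thesis
  proof (rule that)
    show "2 ^ card S \<le> card (subfunctions (\<lambda>\<nu>. \<exists>K\<in>C. \<forall>x\<in>K. \<nu> x) (set (take i vs)))"
      using S X antichain empty_notin
      by (intro subfunctions_ge_unlinked_crossing) (auto intro: finite_subset)
    have "pathwidth V C \<le> c * (c + ?m i)" using i by (intro pathwidth_le_crossing[OF dist V])
    also have "\<dots> \<le> c * (c + card S * c ^ 4)" using S(3) by simp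
    finally show "pathwidth V C \<le> c * (c + card S * c ^ 4)" .
  qed
qed

end

lemma bounded_hypergraph_nf:
  assumes nf: "monotone_nf_on V \<phi>" and ar: "hyper_arity (clauses \<phi>) \<le> c"
    and deg: "hyper_degree V (clauses \<phi>) \<le> c"
  shows "bounded_hypergraph V (clauses \<phi>) c"
proof
  show finV: "finite V" and sub: "\<And>K. K \<in> clauses \<phi> \<Longrightarrow> K \<subseteq> V"
    and anti: "\<And>K L. K \<in> clauses \<phi> \<Longrightarrow> L \<in> clauses \<phi> \<Longrightarrow> K \<subseteq> L \<Longrightarrow> K = L"
    using nf by (auto simp: monotone_nf_on_def)
  \<comment> \<open>An empty clause would be contained in the non-empty one, against
    minimality.\<close>
  show "clauses \<phi> \<noteq> {}" "{} \<notin> clauses \<phi>"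
    using nf by (auto simp: monotone_nf_on_def)
  have fin: "finite (clauses \<phi>)"
    using sub finV by (meson PowI finite_Pow_iff finite_subset subsetI)
  show "card K \<le> c" if "K \<in> clauses \<phi>" for K
    using ar fin that unfolding hyper_arity_def by (meson Max_ge finite_imageI imageI le_trans)
  show "card {K \<in> clauses \<phi>. v \<in> K} \<le> c" if "v \<in> V" for v
    using deg finV that Max_ge[of "(\<lambda>v. card {e \<in> clauses \<phi>. v \<in> e}) ` V"]
    unfolding hyper_degree_def by (meson finite_imageI image_eqI le_trans)
qed

section \<open>The width bounds\<close>

lemma depends_only_on_nf:
  assumes "monotone_nf_on V \<phi>"
  shows "depends_only_on (\<lambda>\<nu>. nf_holds \<nu> \<phi>) V"
proof -
  have sub: "K \<subseteq> V" if "K \<in> clauses \<phi>" for K using assms that by (simp add: monotone_nf_on_def)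
  have "nf_holds \<nu> \<phi> = nf_holds \<mu> \<phi>" if "\<forall>x\<in>V. \<nu> x = \<mu> x" for \<nu> \<mu>
  proof -
    have "(\<forall>x\<in>K. \<nu> x) = (\<forall>x\<in>K. \<mu> x)" "(\<exists>x\<in>K. \<nu> x) = (\<exists>x\<in>K. \<mu> x)" if "K \<in> clauses \<phi>" for K
      using sub[OF that] \<open>\<forall>x\<in>V. \<nu> x = \<mu> x\<close> by blast+
    then show ?thesis by (cases \<phi>) auto
  qed
  then show ?thesis by (auto simp: depends_only_on_def)
qed

lemma min_obdd_width_le:
  assumes "monotone_nf_on V \<phi>" "bounded_hypergraph V (clauses \<phi>) c"
  shows "min_obdd_width V \<phi> \<le> 2 ^ ((pathwidth V (clauses \<phi>) + 1) * c + 1)"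
proof -
  let ?f = "\<lambda>\<nu>. nf_holds \<nu> \<phi>"
  interpret bounded_hypergraph V "clauses \<phi>" c by fact
  obtain vs where vs: "distinct vs" "set vs = V"
    and cross: "\<And>ps. prefix ps vs \<Longrightarrow> card (crossing (clauses \<phi>) (set ps)) \<le> (pathwidth V (clauses \<phi>) + 1) * c"
    using order_with_few_crossing by blast
  obtain D :: "(nat, 'a) bdd" where D: "obdd_with_order V vs D" "captures V D ?f"
    and lev: "\<And>ps. prefix ps vs \<Longrightarrow> card (obdd_level D ps) \<le> card (subfunctions ?f (set ps))"
    using obdd_exists[OF vs depends_only_on_nf[OF assms(1)]] by blast
  have "card (obdd_level D ps) \<le> 2 ^ ((pathwidth V (clauses \<phi>) + 1) * c + 1)" if "prefix ps vs" for ps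
  proof -
    note lev[OF that]
    also have "card (subfunctions ?f (set ps)) \<le> 2 ^ (card (crossing (clauses \<phi>) (set ps)) + 1)"
      unfolding card_subfunctions_nf using finC by (rule card_subfunctions_le_crossing)
    also have "\<dots> \<le> 2 ^ ((pathwidth V (clauses \<phi>) + 1) * c + 1)"
      using cross[OF that] by (intro power_increasing) auto
    finally show ?thesis .
  qed
  then have "obdd_width vs D \<le> 2 ^ ((pathwidth V (clauses \<phi>) + 1) * c + 1)"
    unfolding obdd_width_def by (subst Max_le_iff) auto
  moreover have "min_obdd_width V \<phi> \<le> obdd_width vs D"
    unfolding min_obdd_width_def using D by (intro Least_le) blast
  ultimately show ?thesis by simp
qed

text \<open>An optimal diagram comes with some order of its own, so the lower bound on subfunctions
  must hold for every order.\<close>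

lemma min_obdd_width_ge:
  assumes "monotone_nf_on V \<phi>" "bounded_hypergraph V (clauses \<phi>) c"
  obtains r where "2 ^ r \<le> min_obdd_width V \<phi>" "pathwidth V (clauses \<phi>) \<le> c * (c + r * c ^ 4)"
proof -
  let ?f = "\<lambda>\<nu>. nf_holds \<nu> \<phi>"
  let ?Q = "\<lambda>w. \<exists>vs (D :: (nat, 'a) bdd). obdd_with_order V vs D \<and> captures V D ?f \<and> obdd_width vs D = w"
  interpret bounded_hypergraph V "clauses \<phi>" c by fact
  obtain us where us: "distinct us" "set us = V" using finV finite_distinct_list by blast
  \<comment> \<open>Some diagram exists, so the least width is attained.\<close>
  have "\<exists>w. ?Q w"
    using obdd_exists[OF us depends_only_on_nf[OF assms(1)]] by metis
  then have "?Q (min_obdd_width V \<phi>)" unfolding min_obdd_width_def by (rule LeastI_ex)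
  then obtain vs and D :: "(nat, 'a) bdd" where D: "obdd_with_order V vs D" "captures V D ?f"
    and w: "obdd_width vs D = min_obdd_width V \<phi>" by blast
  then have vs: "distinct vs" "set vs = V" by (auto simp: obdd_with_order_def)
  obtain i r where r: "2 ^ r \<le> card (subfunctions (\<lambda>\<nu>. \<exists>K\<in>clauses \<phi>. \<forall>x\<in>K. \<nu> x) (set (take i vs)))"
    "pathwidth V (clauses \<phi>) \<le> c * (c + r * c ^ 4)"
    using order_has_many_subfunctions[OF vs] by blast
  note r(1)
  also have "card (subfunctions (\<lambda>\<nu>. \<exists>K\<in>clauses \<phi>. \<forall>x\<in>K. \<nu> x) (set (take i vs))) \<le> min_obdd_width V \<phi>"
    using card_subfunctions_le_obdd_width[OF D take_is_prefix] w by (simp add: card_subfunctions_nf)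
  finally show ?thesis using that r(2) by blast
qed

theorem corollary16:
  fixes c :: nat
  shows "\<exists>(\<alpha>::real) (\<beta>::real) (p\<^sub>0::nat). 0 < \<alpha> \<and> \<alpha> \<le> \<beta> \<and>
    (\<forall>(V :: 'v set) (\<phi> :: 'v monotone_nf).
       monotone_nf_on V \<phi> \<and>
       hyper_arity (clauses \<phi>) \<le> c \<and> hyper_degree V (clauses \<phi>) \<le> c \<and>
       p\<^sub>0 \<le> pathwidth V (clauses \<phi>) \<longrightarrow>
         2 powr (\<alpha> * real (pathwidth V (clauses \<phi>))) \<le> real (min_obdd_width V \<phi>) \<and>
         real (min_obdd_width V \<phi>) \<le> 2 powr (\<beta> * real (pathwidth V (clauses \<phi>))))"
proof -
  \<comment> \<open>Using \<open>c + 1\<close> as the bound keeps the divisor below positive when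
    \<open>c = 0\<close>.\<close>
  define d where "d = c + 1"
  \<comment> \<open>Comes from solving \<open>p \<le> 2 * d ^ 5 * r\<close> for
    \<open>r\<close>.\<close>
  define \<alpha> where "\<alpha> = 1 / (2 * real d ^ 5)"
  \<comment> \<open>Chosen so that \<open>(p + 1) * d + 1 \<le> (2 * d + 1) * p\<close> once
    \<open>p \<ge> 1\<close>.\<close>
  define \<beta> where "\<beta> = 2 * real d + 1"
  have d: "real d \<ge> 1" by (simp add: d_def)
  have \<alpha>: "0 < \<alpha>" using d by (simp add: \<alpha>_def)
  have "1 \<le> 2 * real d ^ 5" using one_le_power[OF d, of 5] by linarith
  then have "\<alpha> \<le> 1" unfolding \<alpha>_def by (subst divide_le_eq_1_pos) linarith+
  then have \<beta>: "\<alpha> \<le> \<beta>" using d by (simp add: \<beta>_def)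
  have main: "2 powr (\<alpha> * real p) \<le> real W \<and> real W \<le> 2 powr (\<beta> * real p)"
    if nf: "monotone_nf_on V \<phi>" and ar: "hyper_arity (clauses \<phi>) \<le> c"
      and deg: "hyper_degree V (clauses \<phi>) \<le> c" and large: "2 * d\<^sup>2 \<le> p"
      and p: "p = pathwidth V (clauses \<phi>)" and W: "W = min_obdd_width V \<phi>"
    for V :: "'v set" and \<phi> p W
  proof
    have hyp: "bounded_hypergraph V (clauses \<phi>) d"
      using ar deg by (intro bounded_hypergraph_nf[OF nf]) (auto simp: d_def)
    obtain r where r: "2 ^ r \<le> W" "p \<le> d * (d + r * d ^ 4)"
      using min_obdd_width_ge[OF nf hyp] unfolding p W by blast
    have "d ^ 5 = d * d ^ 4" by (simp add: eval_nat_numeral)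
    then have "d * (d + r * d ^ 4) = d\<^sup>2 + d ^ 5 * r"
      by (simp add: distrib_left power2_eq_square ac_simps)
    \<comment> \<open>The threshold makes the additive \<open>d\<^sup>2\<close> at most half of
      \<open>p\<close>, which costs the factor 2.\<close>
    with r(2) large have "p \<le> 2 * d ^ 5 * r" by linarith
    then have "real p \<le> real (2 * d ^ 5 * r)" by (rule of_nat_mono)
    then have "real p \<le> 2 * real d ^ 5 * real r" by simp
    then have "\<alpha> * real p \<le> real r"
      using d by (simp add: \<alpha>_def divide_le_eq mult.commute)
    then have "2 powr (\<alpha> * real p) \<le> 2 powr real r" by simp
    also have "\<dots> = real (2 ^ r)" by (simp add: powr_realpow)
    also have "\<dots> \<le> real W" using r(1) by (rule of_nat_mono)
    finally show "2 powr (\<alpha> * real p) \<le> real W" .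
    have "1 \<le> p" using large by (simp add: d_def power2_eq_square)
    then have "d * 1 \<le> d * p" by (rule mult_le_mono2)
    moreover have "(p + 1) * d + 1 = d * p + d * 1 + 1" "(2 * d + 1) * p = 2 * (d * p) + p"
      by (simp_all add: algebra_simps)
    ultimately have "(p + 1) * d + 1 \<le> (2 * d + 1) * p" using \<open>1 \<le> p\<close> by linarith
    then have "real ((p + 1) * d + 1) \<le> real ((2 * d + 1) * p)" by (rule of_nat_mono)
    also have "\<dots> = \<beta> * real p" by (simp add: \<beta>_def algebra_simps)
    finally have "real ((p + 1) * d + 1) \<le> \<beta> * real p" .
    then have "2 powr real ((p + 1) * d + 1) \<le> 2 powr (\<beta> * real p)" by simp
    moreover have "real W \<le> real (2 ^ ((p + 1) * d + 1))"
      using min_obdd_width_le[OF nf hyp] unfolding p W by (rule of_nat_mono)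
    moreover have "real (2 ^ ((p + 1) * d + 1)) = 2 powr real ((p + 1) * d + 1)"
      by (subst powr_realpow) simp_all
    ultimately show "real W \<le> 2 powr (\<beta> * real p)" by linarith
  qed
  \<comment> \<open>The witnesses start out schematic: the two facts fix \<alpha> and \<beta>, and
    \<open>main\<close> fixes the threshold to \<open>2 * d\<^sup>2\<close>.\<close>
  show ?thesis
  proof (intro exI conjI allI impI; (elim conjE)?)
    show "0 < \<alpha>" "\<alpha> \<le> \<beta>" by fact+
  qed (use main[OF _ _ _ _ refl refl] in blast)+
qed

end
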